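(* For every positive integer $n$ and all complex numbers $z,y$ with $\sin nz\neq 0$, $$\frac{n\sin(nz+y)}{\sin nz}=\sum_{k=0}^{n-1}\frac{\sin\left(z+y-\frac{k\pi}{n}\right)}{\sin\left(z-\frac{k\pi}{n}\right)}.$$ *)

theory Defs
  imports "HOL-Analysis.Analysis"
begin

end

theory Submission
  imports Defs
begin

text \<open>Each quotient \<open>sin (a + y) / sin a\<close> is an affine function of \<open>1 / (exp (2 * \<i> * a) - 1)\<close>
  with coefficients depending only on \<open>y\<close>, and the shifts of \<open>z\<close> multiply
  \<open>w = exp (2 * \<i> * z)\<close> by the powers of a primitive \<open>n\<close>-th root of unity. Since all these
  multiples have the same \<open>n\<close>-th power \<open>w ^ n\<close>, a geometric sum expands every
  \<open>1 / (w * q ^ k - 1)\<close> over the common denominator \<open>w ^ n - 1\<close>, and orthogonality of the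
  powers of \<open>q\<close> kills all but the constant term.\<close>

text \<open>For \<open>j > 0\<close> this is a geometric sum whose ratio \<open>q ^ j\<close>
  differs from 1 but has \<open>n\<close>-th power 1.\<close>

lemma sum_power_primitive_root:
  fixes q :: "'a::field"
  assumes "q ^ n = 1" and "\<And>j. 0 < j \<Longrightarrow> j < n \<Longrightarrow> q ^ j \<noteq> 1" and "j < n"
  shows "(\<Sum>k<n. (q ^ k) ^ j) = (if j = 0 then of_nat n else 0)"
proof (cases "j = 0")
  case False
  then have "q ^ j \<noteq> 1" using assms by blast
  moreover have "(q ^ j) ^ n = 1"
    using assms(1) by (metis mult.commute power_mult power_one)
  moreover have "(\<Sum>k<n. (q ^ k) ^ j) = (\<Sum>k<n. (q ^ j) ^ k)"
    by (simp flip: power_mult add: mult.commute)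
  ultimately show ?thesis using False by (simp add: sum_gp_strict)
qed simp

text \<open>In the variable \<open>w\<close>, this is the partial fraction decomposition of the
  right-hand side.\<close>

lemma sum_inverse_primitive_root:
  fixes q w :: "'a::field"
  assumes "n > 0" and q: "q ^ n = 1" "\<And>j. 0 < j \<Longrightarrow> j < n \<Longrightarrow> q ^ j \<noteq> 1"
    and w: "w ^ n \<noteq> 1"
  shows "(\<Sum>k<n. 1 / (w * q ^ k - 1)) = of_nat n / (w ^ n - 1)"
proof -
  have "1 / (w * q ^ k - 1) = (\<Sum>j<n. w ^ j * (q ^ k) ^ j) / (w ^ n - 1)" for k
  proof -
    have "(q ^ k) ^ n = 1"
      using q(1) by (metis mult.commute power_mult power_one)
    then have pow: "(w * q ^ k) ^ n = w ^ n" by (simp add: power_mult_distrib)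
    then have "w * q ^ k \<noteq> 1" using w by (metis power_one)
    moreover have "w ^ n - 1 = (w * q ^ k - 1) * (\<Sum>j<n. (w * q ^ k) ^ j)"
      using power_diff_1_eq[of "w * q ^ k" n] pow by simp
    ultimately have "1 / (w * q ^ k - 1) = (\<Sum>j<n. (w * q ^ k) ^ j) / (w ^ n - 1)"
      using w by auto
    then show ?thesis by (simp add: power_mult_distrib)
  qed
  then have "(\<Sum>k<n. 1 / (w * q ^ k - 1)) =
      (\<Sum>k<n. \<Sum>j<n. w ^ j * (q ^ k) ^ j) / (w ^ n - 1)"
    by (simp add: sum_divide_distrib)
  also have "(\<Sum>k<n. \<Sum>j<n. w ^ j * (q ^ k) ^ j) = (\<Sum>j<n. w ^ j * (\<Sum>k<n. (q ^ k) ^ j))"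
    by (subst sum.swap) (simp add: sum_distrib_left)
  also have "\<dots> = (\<Sum>j<n. if j = 0 then of_nat n else 0)"
    by (intro sum.cong) (auto simp: sum_power_primitive_root[OF q])
  also have "\<dots> = of_nat n"
    using \<open>n > 0\<close> by simp
  finally show ?thesis .
qed

text \<open>Euler's formula times \<open>exp (\<i> * a)\<close>. It lets nonvanishing pass between
  \<open>sin a\<close> and \<open>exp (2 * \<i> * a) - 1\<close>.\<close>

lemma sin_eq_exp_diff:
  fixes a :: complex
  shows "2 * \<i> * exp (\<i> * a) * sin a = exp (2 * \<i> * a) - 1"
proof -
  have "2 * \<i> * sin a = exp (\<i> * a) - exp (- (\<i> * a))"
    by (simp add: sin_exp_eq)
  then have "2 * \<i> * exp (\<i> * a) * sin a = exp (\<i> * a) * (exp (\<i> * a) - exp (- (\<i> * a)))"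
    by (metis mult.assoc mult.commute)
  then show ?thesis
    by (simp add: right_diff_distrib mult.assoc flip: exp_add)
qed

text \<open>The quotient is \<open>cos y + sin y * cot a\<close>, and
  \<open>cot a = \<i> + 2 * \<i> / (exp (2 * \<i> * a) - 1)\<close>.\<close>

lemma sin_add_div_sin:
  fixes a y :: complex
  assumes "exp (2 * \<i> * a) \<noteq> 1"
  shows "sin (a + y) / sin a = exp (\<i> * y) + 2 * \<i> * sin y * (1 / (exp (2 * \<i> * a) - 1))"
proof -
  have "sin a \<noteq> 0" using sin_eq_exp_diff[of a] assms by auto
  have cs: "exp (\<i> * t) = cos t + \<i> * sin t" for t :: complex
    by (simp add: exp_Euler)
  have "2 * \<i> * sin y * (1 / (exp (2 * \<i> * a) - 1)) = exp (- (\<i> * a)) * sin y / sin a"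
    unfolding sin_eq_exp_diff[symmetric] by (simp add: exp_minus field_simps)
  also have "\<dots> = sin y * (cos a - \<i> * sin a) / sin a"
    by (simp add: exp_minus_Euler)
  finally show ?thesis
    using \<open>sin a \<noteq> 0\<close> by (simp add: cs sin_add field_simps)
qed

theorem mainTheorem6:
  fixes n :: nat and z y :: complex
  assumes "n > 0"
    and "sin (of_nat n * z) \<noteq> 0"
  shows "of_nat n * sin (of_nat n * z + y) / sin (of_nat n * z) =
    (\<Sum>k = 0..n - 1. sin (z + y - of_nat k * of_real pi / of_nat n) /
                       sin (z - of_nat k * of_real pi / of_nat n))"
proof -
  define w where "w = exp (2 * \<i> * z)"
  \<comment> \<open>The shifts subtract \<open>k * pi / n\<close>, hence the minus sign; the 2 in
    \<open>exp (2 * \<i> * a k)\<close> doubles the angle.\<close>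
  define q where "q = exp (- (2 * of_real pi * \<i> / of_nat n))"
  define a where "a k = z - of_nat k * of_real pi / of_nat n" for k :: nat
  have w_pow: "exp (2 * \<i> * (of_nat n * z)) = w ^ n"
    by (simp add: w_def mult_ac flip: exp_of_nat_mult)
  have w: "w ^ n \<noteq> 1"
    using sin_eq_exp_diff[of "of_nat n * z"] assms(2) w_pow by auto
  \<comment> \<open>The inverse exposes the standard root of unity with positive angle, the form in
    \<open>complex_root_unity_eq_1\<close>.\<close>
  have q_inv: "q ^ j = inverse (exp (2 * of_real pi * \<i> * of_nat j / of_nat n))" for j
    by (simp add: q_def mult_ac flip: exp_of_nat_mult exp_minus)
  have q_n: "q ^ n = 1"
    using \<open>n > 0\<close> by (simp add: q_inv)
  have q_prim: "q ^ j \<noteq> 1" if "0 < j" "j < n" for j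
    using complex_root_unity_eq_1[of n j] that by (auto simp: q_inv dest: dvd_imp_le)
  have exp_a: "exp (2 * \<i> * a k) = w * q ^ k" for k
    by (simp add: w_def q_def a_def right_diff_distrib mult_ac flip: exp_of_nat_mult exp_add)
  \<comment> \<open>Taking \<open>n\<close>-th powers reduces the nonvanishing of every denominator
    in the sum to \<open>w ^ n \<noteq> 1\<close>.\<close>
  have "w * q ^ k \<noteq> 1" for k
  proof
    assume "w * q ^ k = 1"
    then have "w ^ n * (q ^ n) ^ k = 1"
      by (metis mult.commute power_mult power_mult_distrib power_one)
    then show False using w q_n by simp
  qed
  then have term_eq: "sin (a k + y) / sin (a k) =
      exp (\<i> * y) + 2 * \<i> * sin y * (1 / (w * q ^ k - 1))" for k
    using sin_add_div_sin[of "a k" y] by (simp add: exp_a)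
  have "(\<Sum>k = 0..n - 1. sin (z + y - of_nat k * of_real pi / of_nat n) /
                       sin (z - of_nat k * of_real pi / of_nat n)) =
      (\<Sum>k<n. sin (a k + y) / sin (a k))"
    \<comment> \<open>Subtraction is truncated, so \<open>{0..n - 1}\<close> is
      \<open>{..<n}\<close> only because \<open>n > 0\<close>.\<close>
    using \<open>n > 0\<close> by (intro sum.cong) (auto simp: a_def algebra_simps)
  also have "\<dots> = of_nat n * exp (\<i> * y) + 2 * \<i> * sin y * (\<Sum>k<n. 1 / (w * q ^ k - 1))"
    unfolding term_eq sum.distrib by (simp add: sum_distrib_left)
  also have "\<dots> = of_nat n * (exp (\<i> * y) + 2 * \<i> * sin y * (1 / (w ^ n - 1)))"
    by (simp add: sum_inverse_primitive_root[OF \<open>n > 0\<close> q_n q_prim w] algebra_simps)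
  \<comment> \<open>The quotient formula is read backwards at \<open>a = n * z\<close>, where the
    exponential is \<open>w ^ n\<close>.\<close>
  also have "\<dots> = of_nat n * (sin (of_nat n * z + y) / sin (of_nat n * z))"
    using sin_add_div_sin[of "of_nat n * z" y] w by (simp add: w_pow)
  finally show ?thesis by simp
qed

end
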